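(* Let $\mathsf{f}(\mathbf{x};\theta)$ be the merit function (defined in the context) of the parametrized complementarity problem $\mathbb{K}\ni\mathbf{x}\perp\mathbf{F}(\mathbf{x};\theta)\in\mathbb{K}^*$, and let $\mathbf{x}^*=\mathbf{x}^*(\hat\theta)$ be a known solution for $\theta=\hat\theta$ which is an isolated global minimum of $\mathsf{f}(\cdot\,;\hat\theta)$. Assume that at this known solution 1. the condition number of the Hessian $\mathcal{H}=\nabla^2_{\mathbf{x}}\mathsf{f}(\mathbf{x}^*;\hat\theta)$ is finite, equal to $\kappa_H$; 2. the Hessian of $\mathsf{f}$ is Lipschitz continuous (in both $\mathbf{x}$ and $\theta$) near $(\mathbf{x}^*,\hat\theta)$ with a Lipschitz constant $\mathcal{L}$. For a perturbation $\Delta\theta$ of $\hat\theta$ with $\|\Delta\theta\|=\epsilon$, let $\Delta\mathbf{x}$ be the corresponding change in the solution, i.e. $\nabla_{\mathbf{x}}\mathsf{f}(\mathbf{x}^*+\Delta\mathbf{x};\hat\theta+\Delta\theta)=0$ with $\Delta\mathbf{x}\to0$ as $\Delta\theta\to0$, and let $\Delta\mathbf{x}_{\mathrm{lin}}$ be its linear approximation, defined by $$\mathcal{H}\,\Delta\mathbf{x}_{\mathrm{lin}}=-\mathcal{J}\,\Delta\theta,\qquad \mathcal{J}=\nabla_\theta\nabla_{\mathbf{x}}\mathsf{f}(\mathbf{x}^*;\hat\theta).$$ Then the error of the linear approximation is $o(\epsilon)$: $\ \|\Delta\mathbf{x}-\Delta\mathbf{x}_{\mathrm{lin}}\|=o(\epsilon)$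 as $\epsilon\to0$.
   Context: Setting: $\mathcal{I}\subseteq\{1,\dots,n\}$, $\mathbb{K}=\{\mathbf{x}\in\mathbb{R}^n:\mathbf{x}_i\ge0\ \forall i\in\mathcal{I}\}$, $\mathbb{K}^*=\{\mathbf{x}:\mathbf{v}^T\mathbf{x}\ge0\ \forall\mathbf{v}\in\mathbb{K}\}$, and $\mathbf{F}:\mathbb{R}^n\times\mathbb{R}^m\to\mathbb{R}^n$ is twice continuously differentiable in $\mathbf{x}$ and $\theta$ over an open set containing $\mathbb{K}$. The problem $\mathbb{K}\ni\mathbf{x}\perp\mathbf{F}(\mathbf{x};\theta)\in\mathbb{K}^*$ asks for $\mathbf{x}\in\mathbb{K}$ with $\mathbf{F}(\mathbf{x};\theta)\in\mathbb{K}^*$ and $\mathbf{x}^T\mathbf{F}(\mathbf{x};\theta)=0$. A C-function is $\psi:\mathbb{R}^2\to\mathbb{R}$ with $\psi(a,b)=0\iff a\ge0,\ b\ge0,\ ab=0$. The C-function $\psi$ used is assumed twice differentiable (with finite first and second derivatives) at every point of $\{\psi=0\}\setminus\{(0,0)\}$ and to satisfy $\lim_{(a,b)\to(0,0)}\psi^2\,\partial^2\psi/\partial a\partial b=0$. With $\mathcal{Z}=\{i\in\mathcal{I}:\mathbf{x}^*_i=\mathbf{F}_i(\mathbf{x}^*;\hat\theta)=0\}$, put $\Phi_i(\mathbf{x};\theta)=\mathbf{F}_i(\mathbf{x};\theta)$ if $i\notin\mathcal{I}$, $\Phi_i(\mathbf{x};\theta)=\psi^2(\mathbf{x}_i,\mathbf{F}_i(\mathbf{x};\theta))$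 if $i\in\mathcal{Z}$, and $\Phi_i(\mathbf{x};\theta)=\psi(\mathbf{x}_i,\mathbf{F}_i(\mathbf{x};\theta))$ otherwise; the merit function is $\mathsf{f}(\mathbf{x};\theta)=\tfrac12\|\Phi(\mathbf{x};\theta)\|_2^2$. A minimum is isolated if it is the only minimum in some neighborhood of itself. A finite condition number means in particular that $\mathcal{H}$ is invertible. "Hessian of $\mathsf{f}$" in assumption 2 refers to the second derivatives $\nabla^2_{\mathbf{x}}\mathsf{f}$ and $\nabla_\theta\nabla_{\mathbf{x}}\mathsf{f}$. *)

theory Defs
  imports "HOL-Analysis.Analysis" "HOL-Library.Landau_Symbols"
begin

definition twice_differentiable_at ::
  "('a::real_normed_vector \<Rightarrow> 'b::real_normed_vector) \<Rightarrow> 'a \<Rightarrow> bool"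
where
  "twice_differentiable_at f p \<longleftrightarrow>
     (\<exists>D :: 'a \<Rightarrow> 'a \<Rightarrow>\<^sub>L 'b.
        (\<forall>\<^sub>F q in nhds p. (f has_derivative blinfun_apply (D q)) (at q)) \<and>
        D differentiable (at p))"

definition twice_continuously_differentiable_on ::
  "('a::real_normed_vector \<Rightarrow> 'b::real_normed_vector) \<Rightarrow> 'a set \<Rightarrow> bool"
where
  "twice_continuously_differentiable_on f S \<longleftrightarrow>
     (\<exists>(D :: 'a \<Rightarrow> 'a \<Rightarrow>\<^sub>L 'b) (D2 :: 'a \<Rightarrow> 'a \<Rightarrow>\<^sub>L ('a \<Rightarrow>\<^sub>L 'b)).
        (\<forall>z\<in>S. (f has_derivative blinfun_apply (D z)) (at z)) \<and>
        (\<forall>z\<in>S. (D has_derivative blinfun_apply (D2 z)) (at z)) \<and>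
        continuous_on S D2)"

definition nonneg_cone :: "'n::finite set \<Rightarrow> (real^'n) set" where
  "nonneg_cone I = {x. \<forall>i\<in>I. 0 \<le> x $ i}"

definition dual_cone :: "'a::real_inner set \<Rightarrow> 'a set" where
  "dual_cone K = {x. \<forall>v\<in>K. 0 \<le> v \<bullet> x}"

definition solves_complementarity ::
  "(real^'n::finite) set \<Rightarrow> (real^'n \<Rightarrow> real^'n) \<Rightarrow> real^'n \<Rightarrow> bool"
where
  "solves_complementarity K G x \<longleftrightarrow> x \<in> K \<and> G x \<in> dual_cone K \<and> x \<bullet> G x = 0"

definition C_function :: "(real \<times> real \<Rightarrow> real) \<Rightarrow> bool" where
  "C_function \<psi> \<longleftrightarrow> (\<forall>a b. \<psi> (a, b) = 0 \<longleftrightarrow> 0 \<le> a \<and> 0 \<le> b \<and> a * b = 0)"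

definition mixed_partial :: "(real \<times> real \<Rightarrow> real) \<Rightarrow> real \<times> real \<Rightarrow> real" where
  "mixed_partial \<psi> = (\<lambda>(a, b). deriv (\<lambda>s. deriv (\<lambda>t. \<psi> (s, t)) b) a)"

text \<open>The points at which the iterated partial derivative exists, so that the value of
  \<^const>\<open>mixed_partial\<close> is meaningful.\<close>

definition mixed_partial_domain :: "(real \<times> real \<Rightarrow> real) \<Rightarrow> (real \<times> real) set" where
  "mixed_partial_domain \<psi> =
     {(a, b). (\<forall>\<^sub>F s in nhds a. (\<lambda>t. \<psi> (s, t)) field_differentiable (at b)) \<and>
              (\<lambda>s. deriv (\<lambda>t. \<psi> (s, t)) b) field_differentiable (at a)}"

text \<open>The limit at the origin is taken over the points at which the mixed partial exists:
  a C-function such as \<open>min\<close> is not differentiable on the whole of a punctured neighbourhood.\<close>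

definition admissible_C_function :: "(real \<times> real \<Rightarrow> real) \<Rightarrow> bool" where
  "admissible_C_function \<psi> \<longleftrightarrow>
     C_function \<psi> \<and>
     (\<forall>p. \<psi> p = 0 \<and> p \<noteq> (0, 0) \<longrightarrow> twice_differentiable_at \<psi> p) \<and>
     ((\<lambda>p. (\<psi> p)\<^sup>2 * mixed_partial \<psi> p) \<longlongrightarrow> 0) (at (0, 0) within mixed_partial_domain \<psi>)"

definition degenerate_set ::
  "'n::finite set \<Rightarrow> (real^'n \<Rightarrow> real^'m::finite \<Rightarrow> real^'n) \<Rightarrow> real^'n \<Rightarrow> real^'m \<Rightarrow> 'n set"
where
  "degenerate_set I F xs \<theta>h = {i \<in> I. xs $ i = 0 \<and> F xs \<theta>h $ i = 0}"

text \<open>The map \<open>\<Phi>\<close> and the merit function depend on the known solution \<open>xs\<close> at \<open>\<theta>h\<close>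
  through the index set on which the C-function is squared.\<close>

definition merit_map ::
  "'n::finite set \<Rightarrow> (real \<times> real \<Rightarrow> real) \<Rightarrow> (real^'n \<Rightarrow> real^'m::finite \<Rightarrow> real^'n) \<Rightarrow>
   real^'n \<Rightarrow> real^'m \<Rightarrow> real^'n \<Rightarrow> real^'m \<Rightarrow> real^'n"
where
  "merit_map I \<psi> F xs \<theta>h x \<theta> =
     (\<chi> i. if i \<notin> I then F x \<theta> $ i
           else if i \<in> degenerate_set I F xs \<theta>h then (\<psi> (x $ i, F x \<theta> $ i))\<^sup>2
           else \<psi> (x $ i, F x \<theta> $ i))"

definition merit ::
  "'n::finite set \<Rightarrow> (real \<times> real \<Rightarrow> real) \<Rightarrow> (real^'n \<Rightarrow> real^'m::finite \<Rightarrow> real^'n) \<Rightarrow>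
   real^'n \<Rightarrow> real^'m \<Rightarrow> real^'n \<Rightarrow> real^'m \<Rightarrow> real"
where
  "merit I \<psi> F xs \<theta>h x \<theta> = 1/2 * (norm (merit_map I \<psi> F xs \<theta>h x \<theta>))\<^sup>2"

abbreviation global_minimum :: "('a \<Rightarrow> real) \<Rightarrow> 'a \<Rightarrow> bool" where
  "global_minimum g x \<equiv> is_arg_min g (\<lambda>_. True) x"

definition isolated_global_minimum :: "('a::topological_space \<Rightarrow> real) \<Rightarrow> 'a \<Rightarrow> bool" where
  "isolated_global_minimum g x \<longleftrightarrow>
     global_minimum g x \<and>
     (\<exists>N. open N \<and> x \<in> N \<and> (\<forall>y\<in>N. global_minimum g y \<longrightarrow> y = x))"

definition grad_x :: "('a::real_inner \<Rightarrow> 'b \<Rightarrow> real) \<Rightarrow> 'a \<Rightarrow> 'b \<Rightarrow> 'a" where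
  "grad_x f x \<theta> = (THE g. GDERIV (\<lambda>y. f y \<theta>) x :> g)"

definition hess_x ::
  "(real^'n::finite \<Rightarrow> real^'m::finite \<Rightarrow> real) \<Rightarrow> real^'n \<Rightarrow> real^'m \<Rightarrow> real^'n^'n"
where
  "hess_x f x \<theta> = jacobian (\<lambda>y. grad_x f y \<theta>) (at x)"

definition hess_x\<theta> ::
  "(real^'n::finite \<Rightarrow> real^'m::finite \<Rightarrow> real) \<Rightarrow> real^'n \<Rightarrow> real^'m \<Rightarrow> real^'m^'n"
where
  "hess_x\<theta> f x \<theta> = jacobian (\<lambda>t. grad_x f x t) (at \<theta>)"

definition hessian_lipschitz_near ::
  "real \<Rightarrow> (real^'n::finite \<Rightarrow> real^'m::finite \<Rightarrow> real) \<Rightarrow> real^'n \<Rightarrow> real^'m \<Rightarrow> bool"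
where
  "hessian_lipschitz_near L f xs \<theta>h \<longleftrightarrow>
     (\<exists>W. open W \<and> (xs, \<theta>h) \<in> W \<and>
        (\<forall>(x, \<theta>)\<in>W. (\<lambda>y. f y \<theta>) differentiable (at x) \<and>
                     (\<lambda>y. grad_x f y \<theta>) differentiable (at x) \<and>
                     (\<lambda>t. grad_x f x t) differentiable (at \<theta>)) \<and>
        L-lipschitz_on W (\<lambda>(x, \<theta>). hess_x f x \<theta>) \<and>
        L-lipschitz_on W (\<lambda>(x, \<theta>). hess_x\<theta> f x \<theta>))"

definition condition_number :: "real^'n^'n::finite \<Rightarrow> ereal" where
  "condition_number A =
     (if invertible A then ereal (onorm ((*v) A) * onorm ((*v) (matrix_inv A))) else \<infinity>)"

end

theory Submission
  imports Defs
begin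

text \<open>Put \<open>g = \<nabla>\<^sub>x f\<close>. At the global minimum \<open>xs\<close> the gradient vanishes. Since
  \<open>\<nabla>\<^sub>\<theta> g\<close> is continuous near \<open>(xs, \<theta>h)\<close>, \<open>g\<close> is jointly differentiable at that point, with
  derivative \<open>(u, v) \<mapsto> H u + J v\<close>. As \<open>H \<Delta>x_lin + J \<Delta>\<theta> = 0\<close>, this gives
  \<open>0 = g (xs + \<Delta>x, \<theta>h + \<Delta>\<theta>) = H (\<Delta>x - \<Delta>x_lin) + o(\<parallel>\<Delta>x\<parallel> + \<parallel>\<Delta>\<theta>\<parallel>)\<close>.
  Since \<open>H\<close> is invertible and \<open>\<parallel>\<Delta>x\<parallel> \<le> \<parallel>\<Delta>x - \<Delta>x_lin\<parallel> + O(\<parallel>\<Delta>\<theta>\<parallel>)\<close>, the part of the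
  remainder that is proportional to the error is absorbed on the left.\<close>

lemma smallo_plus_self_imp_smallo:
  fixes f g :: "'a \<Rightarrow> real"
  assumes "f \<in> o[F](\<lambda>x. \<bar>f x\<bar> + \<bar>g x\<bar>)"
  shows "f \<in> o[F](g)"
proof (rule landau_o.smallI)
  fix \<epsilon> :: real assume "0 < \<epsilon>"
  then have "\<forall>\<^sub>F x in F. norm (f x) \<le> \<epsilon> / (1 + \<epsilon>) * norm (\<bar>f x\<bar> + \<bar>g x\<bar>)"
    by (intro landau_o.smallD[OF assms]) simp
  then show "\<forall>\<^sub>F x in F. norm (f x) \<le> \<epsilon> * norm (g x)"
  proof eventually_elim
    case (elim x)
    then have "(1 + \<epsilon>) * \<bar>f x\<bar> \<le> \<epsilon> * (\<bar>f x\<bar> + \<bar>g x\<bar>)"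
      using \<open>0 < \<epsilon>\<close> by (simp add: field_simps)
    then show ?case
      by (simp add: algebra_simps)
  qed
qed

lemma has_derivative_imp_remainder_smallo:
  assumes "(f has_derivative f') (at x)"
  shows "(\<lambda>h. norm (f (x + h) - f x - f' h)) \<in> o[nhds 0](norm)"
proof (rule landau_o.smallI)
  fix \<epsilon> :: real assume "0 < \<epsilon>"
  then obtain \<delta> where "0 < \<delta>" and
    "\<And>y. norm (y - x) < \<delta> \<Longrightarrow> norm (f y - f x - f' (y - x)) \<le> \<epsilon> * norm (y - x)"
    using assms unfolding has_derivative_at_alt by blast
  from this(2)[of "x + h" for h] \<open>0 < \<delta>\<close>
  show "\<forall>\<^sub>F h in nhds 0. norm (norm (f (x + h) - f x - f' h)) \<le> \<epsilon> * norm (norm h)"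
    by (auto simp: eventually_nhds_metric)
qed

lemma has_derivative_imp_smallo_at_roots:
  assumes deriv: "(g has_derivative g') (at z)" and "g z = 0"
    and "(Z \<longlongrightarrow> 0) F" and roots: "\<forall>\<^sub>F p in F. g (z + Z p) = 0"
  shows "(\<lambda>p. norm (g' (Z p))) \<in> o[F](\<lambda>p. norm (Z p))"
proof -
  have "(\<lambda>p. norm (g (z + Z p) - g z - g' (Z p))) \<in> o[F](\<lambda>p. norm (Z p))"
    using has_derivative_imp_remainder_smallo[OF deriv] \<open>(Z \<longlongrightarrow> 0) F\<close>
    by (rule landau_o.small.compose)
  moreover have "\<forall>\<^sub>F p in F. norm (g (z + Z p) - g z - g' (Z p)) = norm (g' (Z p))"
    using roots by eventually_elim (simp add: \<open>g z = 0\<close>)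
  ultimately show ?thesis
    by (simp only: landau_o.small.in_cong)
qed

lemma bounded_linear_implicit_solution_bound:
  fixes g :: "'a::real_normed_vector \<times> 'b::real_normed_vector \<Rightarrow> 'c::real_normed_vector"
  assumes "bounded_linear g" and "0 < c" and bounded_below: "\<And>u. c * norm u \<le> norm (g (u, 0))"
  obtains K where "\<And>u v. g (u, v) = 0 \<Longrightarrow> norm u \<le> K * norm v"
proof -
  interpret bounded_linear g by fact
  obtain B where bound: "\<And>z. norm (g z) \<le> norm z * B"
    using bounded by blast
  have "norm u \<le> B / c * norm v" if "g (u, v) = 0" for u v
  proof -
    have "g (u, 0) = - g (0, v)"
      using add[of "(u, 0)" "(0, v)"] that by (simp add: eq_neg_iff_add_eq_0)
    then have "c * norm u \<le> norm v * B"
      using bounded_below[of u] bound[of "(0, v)"] by simp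
    then show ?thesis
      using \<open>0 < c\<close> by (simp add: field_simps)
  qed
  then show thesis
    by (rule that)
qed

lemma norm_Pair_bigo_diff:
  fixes X Y :: "'p \<Rightarrow> 'a::real_normed_vector" and T :: "'p \<Rightarrow> 'b::real_normed_vector"
  assumes "(\<lambda>p. norm (Y p)) \<in> O[F](\<lambda>p. norm (T p))"
  shows "(\<lambda>p. norm (X p, T p)) \<in> O[F](\<lambda>p. norm (X p - Y p) + norm (T p))"
proof -
  have "norm (X p, T p) \<le> norm (X p - Y p) + norm (T p) + norm (Y p)" for p
    using norm_Pair_le[of "X p" "T p"] norm_triangle_sub[of "X p" "Y p"] by simp
  then have "(\<lambda>p. norm (X p, T p)) \<in> O[F](\<lambda>p. norm (X p - Y p) + norm (T p) + norm (Y p))"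
    by (intro landau_o.big_mono) simp
  also have "\<dots> \<subseteq> O[F](\<lambda>p. norm (X p - Y p) + norm (T p))"
  proof (rule landau_o.big_subsetI, rule sum_in_bigo(1)[OF landau_o.big_refl])
    note assms
    also have "(\<lambda>p. norm (T p)) \<in> O[F](\<lambda>p. norm (X p - Y p) + norm (T p))"
      by (intro landau_o.big_mono) simp
    finally show "(\<lambda>p. norm (Y p)) \<in> O[F](\<lambda>p. norm (X p - Y p) + norm (T p))" .
  qed
  finally show ?thesis .
qed

lemma implicit_solution_linearization_smallo:
  fixes g :: "'a::real_normed_vector \<times> 'b::real_normed_vector \<Rightarrow> 'c::real_normed_vector"
    and X Y :: "'p \<Rightarrow> 'a" and T :: "'p \<Rightarrow> 'b"
  assumes deriv: "(g has_derivative g') (at (x, t))"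
    and root: "g (x, t) = 0"
    and "0 < c" and bounded_below: "\<And>u. c * norm u \<le> norm (g' (u, 0))"
    and solution: "\<forall>\<^sub>F p in F. g (x + X p, t + T p) = 0"
    and lim: "(X \<longlongrightarrow> 0) F" "(T \<longlongrightarrow> 0) F"
    and linearized: "\<forall>\<^sub>F p in F. g' (Y p, T p) = 0"
  shows "(\<lambda>p. norm (X p - Y p)) \<in> o[F](\<lambda>p. norm (T p))"
proof -
  interpret g': bounded_linear g'
    using deriv by (rule has_derivative_bounded_linear)
  obtain K where "\<And>u v. g' (u, v) = 0 \<Longrightarrow> norm u \<le> K * norm v"
    using bounded_linear_implicit_solution_bound[OF g'.bounded_linear_axioms \<open>0 < c\<close> bounded_below]
    by blast
  then have "\<forall>\<^sub>F p in F. norm (Y p) \<le> K * norm (T p)"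
    using linearized by (auto elim: eventually_mono)
  then have Y_bigo: "(\<lambda>p. norm (Y p)) \<in> O[F](\<lambda>p. norm (T p))"
    by (intro bigoI[where c = K]) simp

  have "\<forall>\<^sub>F p in F. norm (norm (X p - Y p)) \<le> 1 / c * norm (norm (g' (X p, T p)))"
    using linearized
  proof eventually_elim
    case (elim p)
    then have "g' (X p - Y p, 0) = g' (X p, T p)"
      using g'.diff[of "(X p, T p)" "(Y p, T p)"] by simp
    then show ?case
      using bounded_below[of "X p - Y p"] \<open>0 < c\<close> by (simp add: field_simps)
  qed
  then have "(\<lambda>p. norm (X p - Y p)) \<in> O[F](\<lambda>p. norm (g' (X p, T p)))"
    by (rule bigoI)
  also have "(\<lambda>p. norm (g' (X p, T p))) \<in> o[F](\<lambda>p. norm (X p, T p))"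
    using tendsto_Pair[OF lim] solution
    by (intro has_derivative_imp_smallo_at_roots[OF deriv root]) (simp_all add: zero_prod_def)
  also have "(\<lambda>p. norm (X p, T p)) \<in> O[F](\<lambda>p. norm (X p - Y p) + norm (T p))"
    using Y_bigo by (rule norm_Pair_bigo_diff)
  finally show ?thesis
    by (simp add: smallo_plus_self_imp_smallo)
qed

lemma has_derivative_at_partialsI:
  fixes f :: "'a::real_normed_vector \<Rightarrow> 'b::real_normed_vector \<Rightarrow> 'c::real_normed_vector"
  assumes fx: "((\<lambda>x. f x y) has_derivative fx) (at x)"
    and fy: "\<forall>\<^sub>F (x, y) in nhds (x, y). (f x has_derivative blinfun_apply (fy x y)) (at y)"
    and cont: "isCont (\<lambda>(x, y). fy x y) (x, y)"
  shows "((\<lambda>(x, y). f x y) has_derivative (\<lambda>(u, v). fx u + fy x y v)) (at (x, y))"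
proof -
  obtain W where "open W" "(x, y) \<in> W"
    and fy_W: "\<And>x' y'. (x', y') \<in> W \<Longrightarrow> (f x' has_derivative blinfun_apply (fy x' y')) (at y')"
    using fy unfolding eventually_nhds by blast
  then obtain X Y where "open X" "open Y" "x \<in> X" "y \<in> Y" "X \<times> Y \<subseteq> W"
    using open_prod_elim by (metis mem_Sigma_iff)
  then obtain r where "0 < r" "ball y r \<subseteq> Y"
    using open_contains_ball by metis
  have "((\<lambda>(x, y). f x y) has_derivative (\<lambda>(u, v). fx u + fy x y v))
      (at (x, y) within X \<times> ball y r)"
  proof (rule has_derivative_partialsI)
    show "((\<lambda>x. f x y) has_derivative fx) (at x within X)"
      using fx by (rule has_derivative_at_withinI)
    show "(f x' has_derivative blinfun_apply (fy x' y')) (at y' within ball y r)"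
      if "x' \<in> X" "y' \<in> ball y r" for x' y'
      using that \<open>ball y r \<subseteq> Y\<close> \<open>X \<times> Y \<subseteq> W\<close>
      by (intro has_derivative_at_withinI[OF fy_W]) auto
    show "continuous (at (x, y) within X \<times> ball y r) (\<lambda>(x, y). fy x y)"
      using cont by (rule continuous_at_imp_continuous_at_within)
  qed (use \<open>0 < r\<close> in auto)
  moreover have "at (x, y) within X \<times> ball y r = at (x, y)"
    using \<open>open X\<close> \<open>x \<in> X\<close> \<open>0 < r\<close> by (intro at_within_open) (auto intro: open_Times)
  ultimately show ?thesis
    by simp
qed

lemma bounded_linear_Blinfun_matrix_vector_mult:
  "bounded_linear (\<lambda>M :: real^'m::finite^'n::finite. Blinfun ((*v) M))"
  unfolding linear_conv_bounded_linear[symmetric]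
  by (intro linearI blinfun_eqI)
    (simp_all add: bounded_linear_Blinfun_apply blinfun.add_left blinfun.scaleR_left
      matrix_vector_mult_add_rdistrib scaleR_matrix_vector_assoc)

lemma has_derivative_jacobian_partials:
  fixes g :: "real^'n::finite \<Rightarrow> real^'m::finite \<Rightarrow> real^'k::finite"
  assumes gx: "(\<lambda>y. g y t) differentiable (at x)"
    and gt: "\<forall>\<^sub>F (y, s) in nhds (x, t). g y differentiable (at s)"
    and cont: "isCont (\<lambda>(y, s). jacobian (g y) (at s)) (x, t)"
  shows "((\<lambda>(y, s). g y s) has_derivative
    (\<lambda>(u, v). jacobian (\<lambda>y. g y t) (at x) *v u + jacobian (g x) (at t) *v v)) (at (x, t))"
proof -
  define B where "B y s = Blinfun ((*v) (jacobian (g y) (at s)))" for y s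
  have B_apply: "blinfun_apply (B y s) = (*v) (jacobian (g y) (at s))" for y s
    by (simp add: B_def bounded_linear_Blinfun_apply)
  have "((\<lambda>(y, s). g y s) has_derivative
      (\<lambda>(u, v). jacobian (\<lambda>y. g y t) (at x) *v u + B x t v)) (at (x, t))"
  proof (rule has_derivative_at_partialsI)
    show "((\<lambda>y. g y t) has_derivative (*v) (jacobian (\<lambda>y. g y t) (at x))) (at x)"
      using gx unfolding jacobian_works .
    show "\<forall>\<^sub>F (y, s) in nhds (x, t). (g y has_derivative blinfun_apply (B y s)) (at s)"
      using gt unfolding jacobian_works B_apply .
    show "isCont (\<lambda>(y, s). B y s) (x, t)"
      using bounded_linear.isCont[OF bounded_linear_Blinfun_matrix_vector_mult cont]
      by (simp add: B_def case_prod_unfold)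
  qed
  then show ?thesis
    by (simp add: B_apply)
qed

lemma has_derivative_grad_x:
  assumes "hessian_lipschitz_near L f x t"
  shows "((\<lambda>(y, s). grad_x f y s) has_derivative (\<lambda>(u, v). hess_x f x t *v u + hess_x\<theta> f x t *v v))
    (at (x, t))"
proof -
  obtain W where "open W" "(x, t) \<in> W"
    and diff_x: "\<And>y s. (y, s) \<in> W \<Longrightarrow> (\<lambda>y. grad_x f y s) differentiable (at y)"
    and diff_\<theta>: "\<And>y s. (y, s) \<in> W \<Longrightarrow> grad_x f y differentiable (at s)"
    and lipschitz: "L-lipschitz_on W (\<lambda>(y, s). hess_x\<theta> f y s)"
    using assms unfolding hessian_lipschitz_near_def by blast
  have "isCont (\<lambda>(y, s). hess_x\<theta> f y s) (x, t)"
    using lipschitz_on_continuous_on[OF lipschitz] \<open>open W\<close> \<open>(x, t) \<in> W\<close>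
    by (simp add: continuous_on_eq_continuous_at)
  moreover have "\<forall>\<^sub>F (y, s) in nhds (x, t). grad_x f y differentiable (at s)"
    unfolding eventually_nhds using \<open>open W\<close> \<open>(x, t) \<in> W\<close> diff_\<theta> by blast
  ultimately show ?thesis
    unfolding hess_x_def hess_x\<theta>_def
    using diff_x[OF \<open>(x, t) \<in> W\<close>] by (intro has_derivative_jacobian_partials)
qed

lemma grad_x_eqI:
  assumes "GDERIV (\<lambda>y. f y \<theta>) x :> g"
  shows "grad_x f x \<theta> = g"
  unfolding grad_x_def
proof (rule the_equality)
  show "GDERIV (\<lambda>y. f y \<theta>) x :> g" by (fact assms)
next
  fix g' assume "GDERIV (\<lambda>y. f y \<theta>) x :> g'"
  then have "(\<lambda>h. h \<bullet> g') = (\<lambda>h. h \<bullet> g)"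
    using assms unfolding gderiv_def by (rule has_derivative_unique)
  then show "g' = g"
    by (metis inner_commute vector_eq_ldot)
qed

lemma grad_x_eq_0_if_local_min:
  assumes "(\<lambda>y. f y \<theta>) differentiable (at x)" and "\<forall>\<^sub>F y in at x. f x \<theta> \<le> f y \<theta>"
  shows "grad_x f x \<theta> = 0"
proof -
  obtain D where deriv: "((\<lambda>y. f y \<theta>) has_derivative D) (at x)"
    using assms(1) unfolding differentiable_def by blast
  moreover from deriv assms(2) have "D = (\<lambda>h. 0)"
    by (rule has_derivative_local_min)
  ultimately show ?thesis
    by (intro grad_x_eqI) (simp add: gderiv_def)
qed

lemma condition_number_eq_infinity_iff: "condition_number A = \<infinity> \<longleftrightarrow> \<not> invertible A"
  by (simp add: condition_number_def)

theorem theorem12: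
  fixes I :: "'n::finite set"
    and F :: "real^'n \<Rightarrow> real^'m::finite \<Rightarrow> real^'n"
    and U :: "(real^'n) set"
    and \<psi> :: "real \<times> real \<Rightarrow> real"
    and xs :: "real^'n" and \<theta>h :: "real^'m"
    and \<kappa>\<^sub>H L :: real
    and f :: "real^'n \<Rightarrow> real^'m \<Rightarrow> real"
    and H :: "real^'n^'n" and J :: "real^'m^'n"
    and \<Delta>x \<Delta>x_lin :: "real^'m \<Rightarrow> real^'n"
  assumes "open U" and "nonneg_cone I \<subseteq> U"
    and "twice_continuously_differentiable_on (\<lambda>(x, \<theta>). F x \<theta>) (U \<times> UNIV)"
    and "admissible_C_function \<psi>"
    and f_def: "f = merit I \<psi> F xs \<theta>h"
    and "solves_complementarity (nonneg_cone I) (\<lambda>x. F x \<theta>h) xs"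
    and "isolated_global_minimum (\<lambda>x. f x \<theta>h) xs"
    and H_def: "H = hess_x f xs \<theta>h" and J_def: "J = hess_x\<theta> f xs \<theta>h"
    and "condition_number H = ereal \<kappa>\<^sub>H"
    and "hessian_lipschitz_near L f xs \<theta>h"
    and "\<forall>\<^sub>F \<Delta>\<theta> in at 0. grad_x f (xs + \<Delta>x \<Delta>\<theta>) (\<theta>h + \<Delta>\<theta>) = 0"
    and "(\<Delta>x \<longlongrightarrow> 0) (at 0)"
    and "\<And>\<Delta>\<theta>. H *v \<Delta>x_lin \<Delta>\<theta> = - (J *v \<Delta>\<theta>)"
  shows "(\<lambda>\<Delta>\<theta>. norm (\<Delta>x \<Delta>\<theta> - \<Delta>x_lin \<Delta>\<theta>)) \<in> o[at 0](\<lambda>\<Delta>\<theta>. norm \<Delta>\<theta>)"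
proof -
  have deriv: "((\<lambda>(x, \<theta>). grad_x f x \<theta>) has_derivative (\<lambda>(u, v). H *v u + J *v v)) (at (xs, \<theta>h))"
    unfolding H_def J_def using \<open>hessian_lipschitz_near L f xs \<theta>h\<close> by (rule has_derivative_grad_x)
  have "(\<lambda>x. f x \<theta>h) differentiable (at xs)"
    using \<open>hessian_lipschitz_near L f xs \<theta>h\<close> unfolding hessian_lipschitz_near_def by blast
  then have stationary: "grad_x f xs \<theta>h = 0"
    using \<open>isolated_global_minimum (\<lambda>x. f x \<theta>h) xs\<close>
    by (intro grad_x_eq_0_if_local_min)
      (simp_all add: isolated_global_minimum_def is_arg_min_linorder)
  have "invertible H"
    using \<open>condition_number H = ereal \<kappa>\<^sub>H\<close> condition_number_eq_infinity_iff[of H] by simp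
  then obtain c where "0 < c" and bounded_below: "\<And>u. c * norm u \<le> norm (H *v u)"
    using linear_inj_bounded_below_pos[OF matrix_vector_mul_linear inj_matrix_vector_mult] by blast
  show ?thesis
    by (rule implicit_solution_linearization_smallo[OF deriv _ \<open>0 < c\<close>])
      (use assms stationary bounded_below in auto)
qed

end
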